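(* All the logical rules $0,+,\times,\sqcup,\sqcap$ of $\mathbf{HR}$ are CAN-free invertible: for every instance of one of these rules, if its conclusion has a CAN-free derivation in $\mathbf{HR}$, then each of its premises has a CAN-free derivation in $\mathbf{HR}$.
   Context: Terms. Fix a countable set of variables $x,y,z,\dots$. Terms (in negation normal form) are generated by $A ::= x \mid \overline{x} \mid 0 \mid A+A \mid rA \mid A\sqcup A \mid A\sqcap A$, where $x$ is a variable, $\overline{x}$ is the corresponding negated variable, and $r\in\mathbb{R}_{>0}$. The negation $\overline{A}$ of a term is defined by $\overline{x}$ (for $x$), $\overline{\overline{x}}=x$, $\overline{0}=0$, $\overline{A+B}=\overline{A}+\overline{B}$, $\overline{rA}=r\overline{A}$, $\overline{A\sqcup B}=\overline{A}\sqcap\overline{B}$, $\overline{A\sqcap B}=\overline{A}\sqcup\overline{B}$. A weighted term is $r.A$ with $r\in\mathbb{R}_{>0}$; a sequent $\vdash\Gamma$ has $\Gamma$ a finite (possibly empty) multiset of weighted terms; a hypersequent is a nonempty finite multiset of sequents, written $\vdash\Gamma_1\mid\cdots\mid\vdash\Gamma_n$, and $G\mid\vdash\Gamma$ denotes the hypersequent $G$ with the sequent $\vdash\Gamma$ added. For a finite (possibly empty) sequence $\vec r=(r_1,\dots,r_n)$ of strictly positive reals, $\vec r.A$ is the multiset $r_1.A,\dots,r_n.A$, $\sum\vec r=r_1+\dots+r_n$, and $s\vec r=(sr_1,\dots,sr_n)$; for $s>0$, $s.\Gamma$ multiplies every weight in $\Gamma$ by $s$. The calculus $\mathbf{HR}$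 has the rules (vectors are finite sequences of strictly positive reals): INIT: the hypersequent $\vdash$ (one empty sequent) with no premises. W: from $G$ infer $G\mid\vdash\Gamma$. C: from $G\mid\vdash\Gamma\mid\vdash\Gamma$ infer $G\mid\vdash\Gamma$. S: from $G\mid\vdash\Gamma_1,\Gamma_2$ infer $G\mid\vdash\Gamma_1\mid\vdash\Gamma_2$. M: from $G\mid\vdash\Gamma_1$ and $G\mid\vdash\Gamma_2$ infer $G\mid\vdash\Gamma_1,\Gamma_2$. T: for $r>0$, from $G\mid\vdash r.\Gamma$ infer $G\mid\vdash\Gamma$. ID: if $\sum\vec r=\sum\vec s$, from $G\mid\vdash\Gamma$ infer $G\mid\vdash\Gamma,\vec r.x,\vec s.\overline{x}$ ($x$ a variable). Logical rules — 0: from $G\mid\vdash\Gamma$ infer $G\mid\vdash\Gamma,\vec r.0$. $+$: from $G\mid\vdash\Gamma,\vec r.A,\vec r.B$ infer $G\mid\vdash\Gamma,\vec r.(A+B)$. $\times$: from $G\mid\vdash\Gamma,(s\vec r).A$ infer $G\mid\vdash\Gamma,\vec r.(sA)$. $\sqcup$: from $G\mid\vdash\Gamma,\vec r.A\mid\vdash\Gamma,\vec r.B$ infer $G\mid\vdash\Gamma,\vec r.(A\sqcup B)$. $\sqcap$: from $G\mid\vdash\Gamma,\vec r.A$ and $G\mid\vdash\Gamma,\vec r.B$ infer $G\mid\vdash\Gamma,\vec r.(A\sqcap B)$. CAN: if $\sum\vec r=\sum\vec s$, from $G\mid\vdash\Gamma,\vec s.A,\vec r.\overline{A}$ infer $G\mid\vdash\Gamma$.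 A derivation is a finite tree of rule instances whose leaves are INIT; it is CAN-free if it contains no instance of CAN. *)

theory Defs
  imports Complex_Main "HOL-Library.Multiset"
begin

typedef posreal = "{r :: real. 0 < r}"
  morphisms real_of_posreal posreal_of_real
  by (rule exI[of _ 1]) simp

setup_lifting type_definition_posreal

instantiation posreal :: times
begin
lift_definition times_posreal :: "posreal \<Rightarrow> posreal \<Rightarrow> posreal" is "(*)"
  by simp
instance ..
end

text \<open>Terms are in negation normal form: negation is not a constructor but the
  defined operation \<open>neg\<close>, and \<open>NegVar x\<close> is the negated variable.\<close>

datatype rterm =
    Var nat
  | NegVar nat
  | Zero
  | Plus rterm rterm
  | Scale posreal rterm
  | Join rterm rterm
  | Meet rterm rterm

primrec neg :: "rterm \<Rightarrow> rterm" where
  "neg (Var x) = NegVar x"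
| "neg (NegVar x) = Var x"
| "neg Zero = Zero"
| "neg (Plus A B) = Plus (neg A) (neg B)"
| "neg (Scale r A) = Scale r (neg A)"
| "neg (Join A B) = Meet (neg A) (neg B)"
| "neg (Meet A B) = Join (neg A) (neg B)"

type_synonym weighted_term = "posreal \<times> rterm"
type_synonym sequent = "weighted_term multiset"

text \<open>Hypersequents are nonempty. The type also contains the empty multiset, because the
  context \<open>G\<close> of a rule may be empty; in \<open>rule_instance\<close> below all premises and
  conclusions are nonempty (lemma \<open>rule_instance_nonempty\<close>).\<close>

type_synonym hypersequent = "sequent multiset"

definition vec :: "posreal list \<Rightarrow> rterm \<Rightarrow> sequent" where
  "vec rs A = mset (map (\<lambda>r. (r, A)) rs)"

definition vec_sum :: "posreal list \<Rightarrow> real" where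
  "vec_sum rs = (\<Sum>r\<leftarrow>rs. real_of_posreal r)"

definition scale_vec :: "posreal \<Rightarrow> posreal list \<Rightarrow> posreal list" where
  "scale_vec s rs = map (\<lambda>r. s * r) rs"

definition scale_sequent :: "posreal \<Rightarrow> sequent \<Rightarrow> sequent" where
  "scale_sequent s \<Gamma> = image_mset (\<lambda>(r, A). (s * r, A)) \<Gamma>"

datatype rule_name =
    rINIT | rW | rC | rS | rM | rT | rID
  | rZero | rPlus | rTimes | rJoin | rMeet | rCAN

text \<open>\<open>rule_instance R Ps H\<close>: there is an instance of rule \<open>R\<close> with list of premises \<open>Ps\<close>
  and conclusion \<open>H\<close>.\<close>

inductive rule_instance :: "rule_name \<Rightarrow> hypersequent list \<Rightarrow> hypersequent \<Rightarrow> bool" where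
  INIT: "rule_instance rINIT [] {#{#}#}"
| W: "G \<noteq> {#} \<Longrightarrow> rule_instance rW [G] (G + {#\<Gamma>#})"
| C: "rule_instance rC [G + {#\<Gamma>, \<Gamma>#}] (G + {#\<Gamma>#})"
| S: "rule_instance rS [G + {#\<Gamma>1 + \<Gamma>2#}] (G + {#\<Gamma>1, \<Gamma>2#})"
| M: "rule_instance rM [G + {#\<Gamma>1#}, G + {#\<Gamma>2#}] (G + {#\<Gamma>1 + \<Gamma>2#})"
| T: "rule_instance rT [G + {#scale_sequent r \<Gamma>#}] (G + {#\<Gamma>#})"
| ID: "vec_sum rs = vec_sum ss \<Longrightarrow>
    rule_instance rID [G + {#\<Gamma>#}] (G + {#\<Gamma> + vec rs (Var x) + vec ss (NegVar x)#})"
| Zero: "rule_instance rZero [G + {#\<Gamma>#}] (G + {#\<Gamma> + vec rs Zero#})"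
| Plus: "rule_instance rPlus
    [G + {#\<Gamma> + vec rs A + vec rs B#}]
    (G + {#\<Gamma> + vec rs (Plus A B)#})"
| Times: "rule_instance rTimes
    [G + {#\<Gamma> + vec (scale_vec s rs) A#}]
    (G + {#\<Gamma> + vec rs (Scale s A)#})"
| Join: "rule_instance rJoin
    [G + {#\<Gamma> + vec rs A, \<Gamma> + vec rs B#}]
    (G + {#\<Gamma> + vec rs (Join A B)#})"
| Meet: "rule_instance rMeet
    [G + {#\<Gamma> + vec rs A#}, G + {#\<Gamma> + vec rs B#}]
    (G + {#\<Gamma> + vec rs (Meet A B)#})"
| CAN: "vec_sum rs = vec_sum ss \<Longrightarrow>
    rule_instance rCAN [G + {#\<Gamma> + vec ss A + vec rs (neg A)#}] (G + {#\<Gamma>#})"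

lemma rule_instance_nonempty:
  assumes "rule_instance R Ps H"
  shows "H \<noteq> {#}" and "{#} \<notin> set Ps"
  using assms by (auto elim!: rule_instance.cases)

text \<open>A node carries the rule applied, its conclusion, and the derivations of its premises.\<close>

datatype derivation = Infer rule_name hypersequent "derivation list"

primrec concl :: "derivation \<Rightarrow> hypersequent" where
  "concl (Infer R H ds) = H"

primrec is_HR_derivation :: "derivation \<Rightarrow> bool" where
  "is_HR_derivation (Infer R H ds) \<longleftrightarrow>
    rule_instance R (map concl ds) H \<and> list_all is_HR_derivation ds"

primrec CAN_free :: "derivation \<Rightarrow> bool" where
  "CAN_free (Infer R H ds) \<longleftrightarrow> R \<noteq> rCAN \<and> list_all CAN_free ds"

definition CAN_free_derivable :: "hypersequent \<Rightarrow> bool" where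
  "CAN_free_derivable H \<longleftrightarrow> (\<exists>d. is_HR_derivation d \<and> CAN_free d \<and> concl d = H)"

definition CAN_free_invertible :: "rule_name \<Rightarrow> bool" where
  "CAN_free_invertible R \<longleftrightarrow>
    (\<forall>Ps H. rule_instance R Ps H \<longrightarrow> CAN_free_derivable H \<longrightarrow>
      (\<forall>P \<in> set Ps. CAN_free_derivable P))"

end

theory Submission
  imports Defs
begin

text \<open>
  CAN-free derivability turns out to coincide with validity in the reals: every real valuation
  makes the value of some sequent nonnegative. Invertibility is then a semantic triviality.
  Soundness is immediate. For completeness, the logical rules, read backwards, preserve validity
  and reduce a hypersequent to hypersequents of literals. There, Fourier-Motzkin elimination of a
  variable \<open>x\<close> is a derivation: sequents with coefficients of opposite sign at \<open>x\<close> are rescaled by T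
  and combined by S so that \<open>x\<close> cancels by ID. A valid hypersequent without variables contains the
  empty sequent, hence is derivable by INIT and W.
\<close>

section \<open>Structural rules\<close>

text \<open>Derivations chosen for the premises are grafted under a new node. Later arguments can
  then treat derivability as a predicate closed under the rules and leave trees aside.\<close>

lemma CAN_free_derivable_rule:
  assumes "rule_instance R Ps H" "R \<noteq> rCAN" "\<And>P. P \<in> set Ps \<Longrightarrow> CAN_free_derivable P"
  shows "CAN_free_derivable H"
proof -
  have "\<forall>P\<in>set Ps. \<exists>d. is_HR_derivation d \<and> CAN_free d \<and> concl d = P"
    using assms(3) unfolding CAN_free_derivable_def by blast
  then obtain f where f: "\<And>P. P \<in> set Ps \<Longrightarrow> is_HR_derivation (f P) \<and> CAN_free (f P) \<and> concl (f P) = P"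
    by metis
  have "map concl (map f Ps) = Ps"
    using f by (auto intro: map_idI)
  then have "is_HR_derivation (Infer R H (map f Ps))" "CAN_free (Infer R H (map f Ps))"
    using f assms(1,2) by (auto simp: list_all_iff)
  then show ?thesis
    unfolding CAN_free_derivable_def by (metis concl.simps)
qed

lemma CAN_free_derivable_INIT: "CAN_free_derivable {#{#}#}"
  by (rule CAN_free_derivable_rule[OF INIT]) auto

lemma CAN_free_derivable_nonempty: "CAN_free_derivable H \<Longrightarrow> H \<noteq> {#}"
  unfolding CAN_free_derivable_def
  by (metis concl.simps derivation.exhaust is_HR_derivation.simps rule_instance_nonempty(1))

lemma CAN_free_derivable_weaken:
  assumes "CAN_free_derivable H"
  shows "CAN_free_derivable (H + K)"
proof (induction K)
  case empty
  then show ?case using assms by simp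
next
  case (add \<Gamma> K)
  then show ?case
    using CAN_free_derivable_rule[OF W, of "H + K" \<Gamma>] CAN_free_derivable_nonempty by simp
qed

text \<open>C removes the sequents of \<open>K\<close> one by one, since each has another copy in
  \<open>H\<close>.\<close>

lemma CAN_free_derivable_absorb:
  assumes "CAN_free_derivable (K + H)" "set_mset K \<subseteq> set_mset H"
  shows "CAN_free_derivable H"
  using assms
proof (induction K)
  case empty
  then show ?case by simp
next
  case (add \<Gamma> K)
  then have "\<Gamma> \<in># K + H" by simp
  then obtain G where G: "K + H = G + {#\<Gamma>#}"
    by (metis add_mset_add_single insert_DiffM)
  have "CAN_free_derivable (G + {#\<Gamma>#})"
    by (rule CAN_free_derivable_rule[OF C]) (use add.prems(1) G in simp_all)
  then show ?case using add G by simp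
qed

text \<open>By W and C only the set of sequents matters for derivability, not their
  multiplicities.\<close>

lemma CAN_free_derivable_mono:
  assumes "CAN_free_derivable K" "set_mset K \<subseteq> set_mset H"
  shows "CAN_free_derivable H"
  using CAN_free_derivable_absorb[OF CAN_free_derivable_weaken[OF assms(1)] assms(2)] .

text \<open>The sequents of \<open>K\<close> are traded one at a time for copies of
  \<open>H\<close>, and surplus copies are merged at once. \<open>G\<close> is arbitrary in
  \<open>step\<close> because it has to hold the sequents still waiting.\<close>

lemma CAN_free_derivable_replace_all:
  assumes "CAN_free_derivable K"
    and step: "\<And>\<Gamma> G. \<Gamma> \<in># K \<Longrightarrow> CAN_free_derivable (G + {#\<Gamma>#}) \<Longrightarrow> CAN_free_derivable (G + H)"
  shows "CAN_free_derivable H"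
proof -
  have "CAN_free_derivable (L + H) \<Longrightarrow> set_mset L \<subseteq> set_mset K \<Longrightarrow> CAN_free_derivable H" for L
  proof (induction L)
    case empty
    then show ?case by simp
  next
    case (add \<Gamma> L)
    have "CAN_free_derivable ((L + H) + H)"
      using step[of \<Gamma> "L + H"] add.prems by simp
    then have "CAN_free_derivable (L + H)"
      by (rule CAN_free_derivable_mono) auto
    then show ?case using add by simp
  qed
  then show ?thesis
    using CAN_free_derivable_weaken[OF assms(1)] by blast
qed

section \<open>Semantics in the reals\<close>

primrec eval_term :: "(nat \<Rightarrow> real) \<Rightarrow> rterm \<Rightarrow> real" where
  "eval_term v (Var x) = v x"
| "eval_term v (NegVar x) = - v x"
| "eval_term v Zero = 0"
| "eval_term v (Plus A B) = eval_term v A + eval_term v B"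
| "eval_term v (Scale r A) = real_of_posreal r * eval_term v A"
| "eval_term v (Join A B) = max (eval_term v A) (eval_term v B)"
| "eval_term v (Meet A B) = min (eval_term v A) (eval_term v B)"

definition eval_sequent :: "(nat \<Rightarrow> real) \<Rightarrow> sequent \<Rightarrow> real" where
  "eval_sequent v \<Gamma> = (\<Sum>(r, A)\<in>#\<Gamma>. real_of_posreal r * eval_term v A)"

definition valid :: "hypersequent \<Rightarrow> bool" where
  "valid H \<longleftrightarrow> (\<forall>v. \<exists>\<Gamma>\<in>#H. 0 \<le> eval_sequent v \<Gamma>)"

lemma real_of_posreal_pos [simp]: "0 < real_of_posreal r"
  using real_of_posreal by simp

lemma real_of_posreal_nonneg [simp]: "0 \<le> real_of_posreal r"
  by (rule less_imp_le) simp

lemma real_of_posreal_times [simp]: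
  "real_of_posreal (r * s) = real_of_posreal r * real_of_posreal s"
  by (rule times_posreal.rep_eq)

lemma real_of_posreal_of_real [simp]: "0 < r \<Longrightarrow> real_of_posreal (posreal_of_real r) = r"
  by (simp add: posreal_of_real_inverse)

lemma eval_sequent_empty [simp]: "eval_sequent v {#} = 0"
  by (simp add: eval_sequent_def)

lemma eval_sequent_add_mset [simp]:
  "eval_sequent v (add_mset (r, A) \<Gamma>) = real_of_posreal r * eval_term v A + eval_sequent v \<Gamma>"
  by (simp add: eval_sequent_def)

lemma eval_sequent_union [simp]:
  "eval_sequent v (\<Gamma> + \<Delta>) = eval_sequent v \<Gamma> + eval_sequent v \<Delta>"
  by (simp add: eval_sequent_def)

lemma vec_sum_nonneg: "0 \<le> vec_sum rs"
  unfolding vec_sum_def by (induction rs) simp_all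

lemma vec_sum_scale_vec [simp]: "vec_sum (scale_vec s rs) = real_of_posreal s * vec_sum rs"
  unfolding vec_sum_def scale_vec_def by (induction rs) (auto simp: algebra_simps)

lemma eval_sequent_vec [simp]: "eval_sequent v (vec rs A) = vec_sum rs * eval_term v A"
  unfolding vec_sum_def vec_def by (induction rs) (auto simp: algebra_simps)

lemma eval_sequent_scale [simp]:
  "eval_sequent v (scale_sequent r \<Gamma>) = real_of_posreal r * eval_sequent v \<Gamma>"
  unfolding scale_sequent_def by (induction \<Gamma>) (auto simp: algebra_simps)

text \<open>Checked at one fixed valuation: T because weights are positive, S because a nonnegative
  sum has a nonnegative summand, ID because the two vectors contribute opposite amounts, and Join
  because \<open>vec_sum rs\<close> is nonnegative.\<close>

lemma rule_instance_sound:
  assumes "rule_instance R Ps H" "R \<noteq> rCAN" "\<And>P. P \<in> set Ps \<Longrightarrow> valid P"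
  shows "valid H"
  unfolding valid_def
proof
  fix v
  have prem: "\<exists>\<Gamma>\<in>#P. 0 \<le> eval_sequent v \<Gamma>" if "P \<in> set Ps" for P
    using assms(3) that valid_def by blast
  from assms(1) show "\<exists>\<Gamma>\<in>#H. 0 \<le> eval_sequent v \<Gamma>"
  proof cases
    case (T G r \<Gamma>)
    then show ?thesis using prem real_of_posreal_pos[of r] by (auto simp: zero_le_mult_iff not_le[symmetric])
  next
    case (S G \<Gamma>1 \<Gamma>2)
    then show ?thesis using prem by fastforce
  next
    case (Join G \<Gamma> rs A B)
    have "vec_sum rs * eval_term v A \<le> vec_sum rs * max (eval_term v A) (eval_term v B)"
      "vec_sum rs * eval_term v B \<le> vec_sum rs * max (eval_term v A) (eval_term v B)"
      by (auto intro: mult_left_mono vec_sum_nonneg)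
    then show ?thesis using prem Join by fastforce
  next
    case (M G \<Gamma>1 \<Gamma>2)
    then show ?thesis using prem[of "G + {#\<Gamma>1#}"] prem[of "G + {#\<Gamma>2#}"] by auto
  next
    case (Meet G \<Gamma> rs A B)
    then show ?thesis
      using prem[of "G + {#\<Gamma> + vec rs A#}"] prem[of "G + {#\<Gamma> + vec rs B#}"]
      by (auto simp: min_def)
  qed (use prem assms(2) in \<open>auto simp: algebra_simps\<close>)
qed

lemma CAN_free_derivable_imp_valid:
  assumes "CAN_free_derivable H"
  shows "valid H"
proof -
  have "is_HR_derivation d \<Longrightarrow> CAN_free d \<Longrightarrow> valid (concl d)" for d
  proof (induction d)
    case (Infer R H ds)
    then have "rule_instance R (map concl ds) H" "R \<noteq> rCAN"
      "\<And>P. P \<in> set (map concl ds) \<Longrightarrow> valid P"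
      by (auto simp: list_all_iff)
    then show ?case using rule_instance_sound[of R "map concl ds" H] by simp
  qed
  then show ?thesis
    using assms unfolding CAN_free_derivable_def by blast
qed

text \<open>Invertibility on the semantic side. For \<open>Zero\<close>, \<open>Plus\<close> and
  \<open>Scale\<close> the active sequent keeps its value; a maximum is attained by one of its
  arguments; a minimum lies below both.\<close>

lemma logical_rule_valid_premise:
  assumes "rule_instance R Ps H" "R \<in> {rZero, rPlus, rTimes, rJoin, rMeet}" "valid H" "P \<in> set Ps"
  shows "valid P"
  unfolding valid_def
proof
  fix v
  have concl: "\<exists>\<Gamma>\<in>#H. 0 \<le> eval_sequent v \<Gamma>"
    using assms(3) valid_def by blast
  from assms(1) show "\<exists>\<Gamma>\<in>#P. 0 \<le> eval_sequent v \<Gamma>"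
  proof cases
    case (Meet G \<Gamma> rs A B)
    have "vec_sum rs * min (eval_term v A) (eval_term v B) \<le> vec_sum rs * eval_term v A"
      "vec_sum rs * min (eval_term v A) (eval_term v B) \<le> vec_sum rs * eval_term v B"
      by (auto intro: mult_left_mono vec_sum_nonneg)
    then show ?thesis
      using Meet assms(4) concl by fastforce
  qed (use concl assms(2,4) in \<open>auto simp: algebra_simps max_def split: if_splits\<close>)
qed

section \<open>Hypersequents of literals\<close>

text \<open>\<open>Zero\<close> does not count as a literal, so over the empty set of variables only
  the empty sequent remains.\<close>

definition literals_over :: "nat set \<Rightarrow> sequent \<Rightarrow> bool" where
  "literals_over V \<Gamma> \<longleftrightarrow> snd ` set_mset \<Gamma> \<subseteq> Var ` V \<union> NegVar ` V"

definition coefficient :: "nat \<Rightarrow> sequent \<Rightarrow> real" where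
  "coefficient x \<Gamma> = (\<Sum>(r, A)\<in>#\<Gamma>. real_of_posreal r *
     (if A = Var x then 1 else if A = NegVar x then - 1 else 0))"

definition drop_variable :: "nat \<Rightarrow> sequent \<Rightarrow> sequent" where
  "drop_variable x \<Gamma> = filter_mset (\<lambda>(r, A). A \<noteq> Var x \<and> A \<noteq> NegVar x) \<Gamma>"

lemma literals_over_union [simp]:
  "literals_over V (\<Gamma> + \<Delta>) \<longleftrightarrow> literals_over V \<Gamma> \<and> literals_over V \<Delta>"
  by (auto simp: literals_over_def)

lemma literals_over_scale [simp]: "literals_over V (scale_sequent r \<Gamma>) \<longleftrightarrow> literals_over V \<Gamma>"
  by (simp add: literals_over_def scale_sequent_def image_image split_def)

lemma literals_over_drop_variable:
  assumes "literals_over (insert x V) \<Gamma>"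
  shows "literals_over V (drop_variable x \<Gamma>)"
  using assms unfolding literals_over_def drop_variable_def by fastforce

lemma coefficient_union [simp]: "coefficient x (\<Gamma> + \<Delta>) = coefficient x \<Gamma> + coefficient x \<Delta>"
  by (simp add: coefficient_def)

lemma coefficient_scale [simp]:
  "coefficient x (scale_sequent r \<Gamma>) = real_of_posreal r * coefficient x \<Gamma>"
  unfolding coefficient_def scale_sequent_def by (induction \<Gamma>) (auto simp: algebra_simps)

lemma drop_variable_union [simp]:
  "drop_variable x (\<Gamma> + \<Delta>) = drop_variable x \<Gamma> + drop_variable x \<Delta>"
  by (simp add: drop_variable_def)

lemma drop_variable_scale [simp]:
  "drop_variable x (scale_sequent r \<Gamma>) = scale_sequent r (drop_variable x \<Gamma>)"
  unfolding drop_variable_def scale_sequent_def by (induction \<Gamma>) auto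

text \<open>Brings a sequent into the shape of a conclusion of ID, whose side condition then says
  that the coefficient of \<open>x\<close> is zero.\<close>

lemma sequent_split_variable:
  "\<exists>rs ss. \<Gamma> = drop_variable x \<Gamma> + vec rs (Var x) + vec ss (NegVar x)
     \<and> coefficient x \<Gamma> = vec_sum rs - vec_sum ss"
proof (induction \<Gamma>)
  case empty
  show ?case
    by (rule exI[of _ "[]"])+ (simp add: drop_variable_def coefficient_def vec_def vec_sum_def)
next
  case (add p \<Gamma>)
  obtain r A where p: "p = (r, A)" by fastforce
  obtain rs ss where IH: "\<Gamma> = drop_variable x \<Gamma> + vec rs (Var x) + vec ss (NegVar x)"
      "coefficient x \<Gamma> = vec_sum rs - vec_sum ss"
    using add by blast
  consider "A = Var x" | "A = NegVar x" | "A \<noteq> Var x" "A \<noteq> NegVar x" by blast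
  then show ?case
  proof cases
    case 1
    show ?thesis
      by (rule exI[of _ "r # rs"], rule exI[of _ ss])
        (use IH 1 p in \<open>auto simp: drop_variable_def coefficient_def vec_def vec_sum_def\<close>)
  next
    case 2
    show ?thesis
      by (rule exI[of _ rs], rule exI[of _ "r # ss"])
        (use IH 2 p in \<open>auto simp: drop_variable_def coefficient_def vec_def vec_sum_def\<close>)
  next
    case 3
    show ?thesis
      by (rule exI[of _ rs], rule exI[of _ ss])
        (use IH 3 p in \<open>auto simp: drop_variable_def coefficient_def vec_def vec_sum_def\<close>)
  qed
qed

section \<open>Fourier-Motzkin elimination of a single variable\<close>

lemma CAN_free_derivable_cancel_variable:
  assumes "coefficient x \<Gamma> = 0" "CAN_free_derivable (G + {#drop_variable x \<Gamma>#})"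
  shows "CAN_free_derivable (G + {#\<Gamma>#})"
proof -
  obtain rs ss where *: "\<Gamma> = drop_variable x \<Gamma> + vec rs (Var x) + vec ss (NegVar x)"
      "coefficient x \<Gamma> = vec_sum rs - vec_sum ss"
    using sequent_split_variable by blast
  have "vec_sum rs = vec_sum ss" using * assms(1) by simp
  from CAN_free_derivable_rule[OF ID[OF this, of G "drop_variable x \<Gamma>" x]] assms(2)
  show ?thesis using *(1) by simp
qed

text \<open>The value of a sequent of literals is affine in the value given to \<open>x\<close>,
  with slope \<open>coefficient x \<Gamma>\<close>. Refuting a hypersequent of literals thus means
  solving strict linear inequalities.\<close>

lemma eval_sequent_update:
  assumes "literals_over (insert x V) \<Gamma>"
  shows "eval_sequent (v(x := a)) \<Gamma> = eval_sequent v (drop_variable x \<Gamma>) + coefficient x \<Gamma> * a"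
  using assms
proof (induction \<Gamma>)
  case empty
  show ?case by (simp add: coefficient_def drop_variable_def)
next
  case (add p \<Gamma>)
  obtain r A where p: "p = (r, A)" by fastforce
  then obtain y where "A = Var y \<or> A = NegVar y"
    using add.prems by (auto simp: literals_over_def)
  moreover have "eval_sequent (v(x := a)) \<Gamma> = eval_sequent v (drop_variable x \<Gamma>) + coefficient x \<Gamma> * a"
    using add by (simp add: literals_over_def del: fun_upd_apply)
  ultimately show ?case
    using p by (cases "y = x")
      (auto simp: coefficient_def drop_variable_def algebra_simps fun_upd_same fun_upd_other
        simp del: fun_upd_apply)
qed

text \<open>Solvability of strict bounds in one unknown. Empty sets are treated apart because
  \<open>Max\<close> and \<open>Min\<close> carry no information there.\<close>

lemma finite_sets_separated:
  fixes L U :: "real set"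
  assumes "finite L" "finite U" "\<And>l u. l \<in> L \<Longrightarrow> u \<in> U \<Longrightarrow> l < u"
  shows "\<exists>a. (\<forall>l\<in>L. l < a) \<and> (\<forall>u\<in>U. a < u)"
proof -
  consider "L = {}" "U = {}" | "L = {}" "U \<noteq> {}" | "L \<noteq> {}" "U = {}" | "L \<noteq> {}" "U \<noteq> {}"
    by blast
  then show ?thesis
  proof cases
    case 1
    then show ?thesis by simp
  next
    case 2
    obtain a where "a < Min U" using lt_ex by blast
    then show ?thesis using 2 assms(2) by auto
  next
    case 3
    obtain a where "Max L < a" using gt_ex by blast
    then show ?thesis using 3 assms(1) by auto
  next
    case 4
    then obtain a where "Max L < a" "a < Min U"
      using assms dense[of "Max L" "Min U"] by auto
    then show ?thesis using 4 assms(1,2) by auto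
  qed
qed

text \<open>The positive combination in which \<open>x\<close> cancels. It is meant for a positive
  coefficient in \<open>\<Gamma>\<close> and a negative one in \<open>\<Delta>\<close>, so that both
  factors really are positive.\<close>

definition combine :: "nat \<Rightarrow> sequent \<Rightarrow> sequent \<Rightarrow> sequent" where
  "combine x \<Gamma> \<Delta> = scale_sequent (posreal_of_real (- coefficient x \<Delta>)) \<Gamma>
     + scale_sequent (posreal_of_real (coefficient x \<Gamma>)) \<Delta>"

text \<open>S separates the two scaled parts, then T undoes each scaling in turn.\<close>

lemma CAN_free_derivable_combine:
  assumes "CAN_free_derivable (G + {#combine x \<Gamma> \<Delta>#})"
  shows "CAN_free_derivable (G + {#\<Gamma>, \<Delta>#})"
proof -
  define r s where "r = posreal_of_real (- coefficient x \<Delta>)" and "s = posreal_of_real (coefficient x \<Gamma>)"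
  have "CAN_free_derivable (G + {#scale_sequent r \<Gamma> + scale_sequent s \<Delta>#})"
    using assms unfolding combine_def r_def s_def .
  then have "CAN_free_derivable (G + {#scale_sequent r \<Gamma>, scale_sequent s \<Delta>#})"
    using CAN_free_derivable_rule[OF S[of G "scale_sequent r \<Gamma>" "scale_sequent s \<Delta>"]] by simp
  then have "CAN_free_derivable (G + {#scale_sequent r \<Gamma>#} + {#\<Delta>#})"
    using CAN_free_derivable_rule[OF T[of "G + {#scale_sequent r \<Gamma>#}" s \<Delta>]]
    by (simp add: add_mset_commute)
  then have "CAN_free_derivable (G + {#\<Delta>#} + {#\<Gamma>#})"
    using CAN_free_derivable_rule[OF T[of "G + {#\<Delta>#}" r \<Gamma>]] by (simp add: add_mset_commute)
  then show ?thesis by (simp add: add_mset_commute)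
qed

text \<open>The Fourier-Motzkin projection along \<open>x\<close>. A sequent with nonzero
  coefficient survives only through its pairings with sequents of opposite sign.\<close>

definition eliminate :: "nat \<Rightarrow> hypersequent \<Rightarrow> sequent set" where
  "eliminate x H = drop_variable x ` {\<Gamma> \<in> set_mset H. coefficient x \<Gamma> = 0}
     \<union> (\<lambda>(\<Gamma>, \<Delta>). drop_variable x (combine x \<Gamma> \<Delta>)) `
       ({\<Gamma> \<in> set_mset H. 0 < coefficient x \<Gamma>} \<times> {\<Delta> \<in> set_mset H. coefficient x \<Delta> < 0})"

lemma finite_eliminate [simp]: "finite (eliminate x H)"
  by (simp add: eliminate_def)

lemma CAN_free_derivable_eliminate:
  assumes "CAN_free_derivable (mset_set (eliminate x H))"
  shows "CAN_free_derivable H"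
  using assms
proof (rule CAN_free_derivable_replace_all)
  fix \<Theta> G
  assume "\<Theta> \<in># mset_set (eliminate x H)" and D: "CAN_free_derivable (G + {#\<Theta>#})"
  then have "\<Theta> \<in> eliminate x H" by simp
  then consider \<Gamma> where "\<Gamma> \<in># H" "coefficient x \<Gamma> = 0" "\<Theta> = drop_variable x \<Gamma>"
    | \<Gamma> \<Delta> where "\<Gamma> \<in># H" "\<Delta> \<in># H" "0 < coefficient x \<Gamma>" "coefficient x \<Delta> < 0"
        "\<Theta> = drop_variable x (combine x \<Gamma> \<Delta>)"
    unfolding eliminate_def by auto
  then show "CAN_free_derivable (G + H)"
  proof cases
    case 1
    then have "CAN_free_derivable (G + {#\<Gamma>#})"
      using CAN_free_derivable_cancel_variable D by simp
    then show ?thesis by (rule CAN_free_derivable_mono) (use 1 in auto)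
  next
    case 2
    \<comment> \<open>The signs in this case make the arguments of \<open>posreal_of_real\<close>
      positive, so the two cross products cancel.\<close>
    then have "coefficient x (combine x \<Gamma> \<Delta>) = 0"
      by (simp add: combine_def)
    then have "CAN_free_derivable (G + {#\<Gamma>, \<Delta>#})"
      using CAN_free_derivable_cancel_variable CAN_free_derivable_combine D 2 by blast
    then show ?thesis by (rule CAN_free_derivable_mono) (use 2 in auto)
  qed
qed

text \<open>By contraposition: a valuation refuting the projection is turned into one refuting
  \<open>H\<close> by changing its value at \<open>x\<close> alone.\<close>

lemma valid_eliminate:
  assumes "valid H" "\<And>\<Gamma>. \<Gamma> \<in># H \<Longrightarrow> literals_over (insert x V) \<Gamma>"
  shows "valid (mset_set (eliminate x H))"
proof (rule ccontr)
  assume "\<not> valid (mset_set (eliminate x H))"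
  then obtain v where v: "\<And>\<Theta>. \<Theta> \<in> eliminate x H \<Longrightarrow> eval_sequent v \<Theta> < 0"
    unfolding valid_def by (auto simp: not_le)
  define P where "P = {\<Gamma> \<in> set_mset H. 0 < coefficient x \<Gamma>}"
  define N where "N = {\<Gamma> \<in> set_mset H. coefficient x \<Gamma> < 0}"
  \<comment> \<open>\<open>b \<Gamma>\<close> is the zero of the affine function belonging to
    \<open>\<Gamma>\<close>: an upper bound for the new value of \<open>x\<close> if
    \<open>\<Gamma>\<close> is in \<open>P\<close>, a lower bound if it is in
    \<open>N\<close>.\<close>
  define b where "b \<Gamma> = - eval_sequent v (drop_variable x \<Gamma>) / coefficient x \<Gamma>" for \<Gamma>
  have less: "b \<Delta> < b \<Gamma>" if "\<Gamma> \<in> P" "\<Delta> \<in> N" for \<Gamma> \<Delta>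
  proof -
    have "drop_variable x (combine x \<Gamma> \<Delta>) \<in> eliminate x H"
      using that unfolding eliminate_def P_def N_def by auto
    then have "- coefficient x \<Delta> * eval_sequent v (drop_variable x \<Gamma>)
        + coefficient x \<Gamma> * eval_sequent v (drop_variable x \<Delta>) < 0"
      using v[of "drop_variable x (combine x \<Gamma> \<Delta>)"] that by (simp add: combine_def P_def N_def)
    \<comment> \<open>Divide by the positive number
      \<open>- coefficient x \<Delta> * coefficient x \<Gamma>\<close>.\<close>
    then show ?thesis
      using that by (simp add: P_def N_def b_def divide_simps mult.commute)
  qed
  have "finite (b ` N)" "finite (b ` P)"
    by (simp_all add: P_def N_def)
  then have "\<exists>a. (\<forall>l\<in>b ` N. l < a) \<and> (\<forall>u\<in>b ` P. a < u)"
    by (rule finite_sets_separated) (use less in auto)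
  then obtain a where "\<forall>l\<in>b ` N. l < a" "\<forall>u\<in>b ` P. a < u"
    by (elim exE conjE)
  then have a: "\<And>\<Delta>. \<Delta> \<in> N \<Longrightarrow> b \<Delta> < a" "\<And>\<Gamma>. \<Gamma> \<in> P \<Longrightarrow> a < b \<Gamma>"
    by simp_all
  have "eval_sequent (v(x := a)) \<Gamma> < 0" if "\<Gamma> \<in># H" for \<Gamma>
  proof -
    have eq: "eval_sequent (v(x := a)) \<Gamma> = eval_sequent v (drop_variable x \<Gamma>) + coefficient x \<Gamma> * a"
      using eval_sequent_update assms(2) that by blast
    consider "coefficient x \<Gamma> = 0" | "\<Gamma> \<in> P" | "\<Gamma> \<in> N"
      using \<open>\<Gamma> \<in># H\<close> by (cases "coefficient x \<Gamma>" "0 :: real" rule: linorder_cases) (auto simp: P_def N_def)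
    then show ?thesis
    proof cases
      case 1
      then have "drop_variable x \<Gamma> \<in> eliminate x H"
        using that by (auto simp: eliminate_def)
      then show ?thesis using eq v 1 by simp
    next
      case 2
      then show ?thesis using eq a(2)[OF 2] by (simp add: b_def P_def field_simps)
    next
      case 3
      then show ?thesis using eq a(1)[OF 3] by (simp add: b_def N_def field_simps)
    qed
  qed
  then show False
    using assms(1) unfolding valid_def by (meson not_le)
qed

text \<open>Each induction step eliminates one variable: validity passes to the projection, and
  derivability comes back from it.\<close>

lemma valid_literals_imp_CAN_free_derivable:
  assumes "finite V" "\<And>\<Gamma>. \<Gamma> \<in># H \<Longrightarrow> literals_over V \<Gamma>" "valid H"
  shows "CAN_free_derivable H"
  using assms
proof (induction V arbitrary: H)
  case empty
  then have "\<And>\<Gamma>. \<Gamma> \<in># H \<Longrightarrow> \<Gamma> = {#}"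
    by (auto simp: literals_over_def)
  \<comment> \<open>The empty hypersequent is not valid, so \<open>H\<close> contains at least one,
    necessarily empty, sequent.\<close>
  moreover have "\<exists>\<Gamma>. \<Gamma> \<in># H"
    using empty(2) unfolding valid_def by blast
  ultimately show ?case
    by (intro CAN_free_derivable_mono[OF CAN_free_derivable_INIT]) auto
next
  case (insert x V)
  have "literals_over V \<Theta>" if "\<Theta> \<in> eliminate x H" for \<Theta>
    using that insert.prems(1) unfolding eliminate_def combine_def
    by (auto intro!: literals_over_drop_variable simp del: drop_variable_union drop_variable_scale)
  then have "CAN_free_derivable (mset_set (eliminate x H))"
    using insert.IH[of "mset_set (eliminate x H)"] valid_eliminate[OF insert.prems(2,1)] by simp
  then show ?case by (rule CAN_free_derivable_eliminate)
qed

section \<open>Completeness\<close>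

text \<open>The factor 2 pays for the additional weighted term produced by splitting a
  \<open>Plus\<close>; the summand 1 makes the removal of \<open>Zero\<close> a strict decrease.
  Real weights are ignored, so rescaling costs nothing.\<close>

definition sequent_weight :: "sequent \<Rightarrow> nat" where
  "sequent_weight \<Gamma> = (\<Sum>(r, A)\<in>#\<Gamma>. 2 * size A + 1)"

text \<open>The base 3 compensates for the rule for joins, which replaces one sequent by two.\<close>

definition hypersequent_weight :: "hypersequent \<Rightarrow> nat" where
  "hypersequent_weight H = (\<Sum>\<Gamma>\<in>#H. 3 ^ sequent_weight \<Gamma>)"

lemma sequent_weight_union [simp]:
  "sequent_weight (\<Gamma> + \<Delta>) = sequent_weight \<Gamma> + sequent_weight \<Delta>"
  by (simp add: sequent_weight_def)

lemma sequent_weight_vec_singleton [simp]: "sequent_weight (vec [r] A) = 2 * size A + 1"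
  by (simp add: sequent_weight_def vec_def)

lemma hypersequent_weight_less:
  assumes "sequent_weight \<Delta> < sequent_weight \<Gamma>"
  shows "hypersequent_weight (G + {#\<Delta>#}) < hypersequent_weight (G + {#\<Gamma>#})"
  using assms by (simp add: hypersequent_weight_def)

lemma hypersequent_weight_less_two:
  assumes "sequent_weight \<Delta> < sequent_weight \<Gamma>" "sequent_weight \<Theta> < sequent_weight \<Gamma>"
  shows "hypersequent_weight (G + {#\<Delta>, \<Theta>#}) < hypersequent_weight (G + {#\<Gamma>#})"
proof -
  \<comment> \<open>Both smaller weights are at most \<open>n\<close>, and
    \<open>2 * 3 ^ n < 3 ^ Suc n\<close>.\<close>
  obtain n where n: "sequent_weight \<Gamma> = Suc n" "sequent_weight \<Delta> \<le> n" "sequent_weight \<Theta> \<le> n"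
    using assms by (cases "sequent_weight \<Gamma>") auto
  have "(3::nat) ^ sequent_weight \<Delta> \<le> 3 ^ n" "(3::nat) ^ sequent_weight \<Theta> \<le> 3 ^ n"
    using n by (auto intro: power_increasing)
  moreover have "(0::nat) < 3 ^ n" by simp
  ultimately have "(3::nat) ^ sequent_weight \<Delta> + 3 ^ sequent_weight \<Theta> < 3 ^ sequent_weight \<Gamma>"
    unfolding n(1) power_Suc by linarith
  then show ?thesis by (simp add: hypersequent_weight_def)
qed

text \<open>One backward step of proof search. Decomposing a single weighted term, with the vector
  \<open>[r]\<close>, is enough for completeness.\<close>

lemma logical_rule_for_compound:
  assumes "\<And>x. A \<noteq> Var x" "\<And>x. A \<noteq> NegVar x"
  shows "\<exists>R\<in>{rZero, rPlus, rTimes, rJoin, rMeet}. \<exists>Ps. rule_instance R Ps (G + {#\<Gamma> + vec [r] A#})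
    \<and> (\<forall>P\<in>set Ps. hypersequent_weight P < hypersequent_weight (G + {#\<Gamma> + vec [r] A#}))"
proof (cases A)
  case Zero
  then show ?thesis
    using rule_instance.Zero[of G \<Gamma> "[r]"] hypersequent_weight_less[of \<Gamma> "\<Gamma> + vec [r] A" G]
    by fastforce
next
  case (Plus B C)
  then show ?thesis
    using rule_instance.Plus[of G \<Gamma> "[r]" B C]
      hypersequent_weight_less[of "\<Gamma> + vec [r] B + vec [r] C" "\<Gamma> + vec [r] A" G]
    by fastforce
next
  case (Scale s B)
  then show ?thesis
    using rule_instance.Times[of G \<Gamma> s "[r]" B]
      hypersequent_weight_less[of "\<Gamma> + vec [s * r] B" "\<Gamma> + vec [r] A" G]
    by (fastforce simp: scale_vec_def)
next
  case (Join B C)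
  then show ?thesis
    using rule_instance.Join[of G \<Gamma> "[r]" B C]
      hypersequent_weight_less_two[of "\<Gamma> + vec [r] B" "\<Gamma> + vec [r] A" "\<Gamma> + vec [r] C" G]
    by fastforce
next
  case (Meet B C)
  then show ?thesis
    using rule_instance.Meet[of G \<Gamma> "[r]" B C]
      hypersequent_weight_less[of "\<Gamma> + vec [r] B" "\<Gamma> + vec [r] A" G]
      hypersequent_weight_less[of "\<Gamma> + vec [r] C" "\<Gamma> + vec [r] A" G]
    by fastforce
qed (use assms in auto)

text \<open>Induction on the weight: either every term is a literal, or a compound one is decomposed
  into lighter premises that are still valid.\<close>

lemma valid_imp_CAN_free_derivable: "valid H \<Longrightarrow> CAN_free_derivable H"
proof (induction H rule: measure_induct_rule[of hypersequent_weight])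
  case (less H)
  show ?case
  proof (cases "\<exists>V. finite V \<and> (\<forall>\<Gamma>\<in>#H. literals_over V \<Gamma>)")
    case True
    then show ?thesis using valid_literals_imp_CAN_free_derivable less.prems by blast
  next
    case False
    \<comment> \<open>With all variables of the literals of \<open>H\<close> in \<open>V\<close>, a
      term violating \<open>literals_over V\<close> cannot be a literal.\<close>
    define V where "V = {x. \<exists>A\<in>\<Union>((\<lambda>\<Gamma>. snd ` set_mset \<Gamma>) ` set_mset H). A = Var x \<or> A = NegVar x}"
    \<comment> \<open>Finiteness comes from the finitely many terms of \<open>H\<close>; the value 0
      on other terms is arbitrary, as only an inclusion is claimed.\<close>
    have "V \<subseteq> (\<lambda>A. case A of Var x \<Rightarrow> x | NegVar x \<Rightarrow> x | _ \<Rightarrow> 0) `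
        \<Union>((\<lambda>\<Gamma>. snd ` set_mset \<Gamma>) ` set_mset H)"
      unfolding V_def by force
    then have "finite V" by (rule finite_subset) simp
    then obtain \<Gamma> where \<Gamma>: "\<Gamma> \<in># H" "\<not> literals_over V \<Gamma>" using False by blast
    then obtain r A where rA: "(r, A) \<in># \<Gamma>" "A \<notin> Var ` V \<union> NegVar ` V"
      unfolding literals_over_def by fastforce
    then have nonliteral: "\<And>x. A \<noteq> Var x" "\<And>x. A \<noteq> NegVar x"
      using \<Gamma>(1) unfolding V_def by force+
    obtain \<Delta> where "\<Gamma> = \<Delta> + vec [r] A"
      using rA(1) by (auto simp: vec_def dest: multi_member_split)
    then obtain G where H: "H = G + {#\<Delta> + vec [r] A#}"
      using \<Gamma>(1) by (auto dest: multi_member_split)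
    obtain R Ps where R: "R \<in> {rZero, rPlus, rTimes, rJoin, rMeet}" "rule_instance R Ps H"
        "\<And>P. P \<in> set Ps \<Longrightarrow> hypersequent_weight P < hypersequent_weight H"
      using logical_rule_for_compound[OF nonliteral, of G \<Delta> r, folded H] by blast
    have "CAN_free_derivable P" if "P \<in> set Ps" for P
      using less.IH R(3) logical_rule_valid_premise[OF R(2,1) less.prems] that by blast
    then show ?thesis
      using CAN_free_derivable_rule[OF R(2)] R(1) by auto
  qed
qed

theorem theorem3p11:
  shows "\<forall>R \<in> {rZero, rPlus, rTimes, rJoin, rMeet}. CAN_free_invertible R"
  \<comment> \<open>Only the validity of the conclusion is carried over; completeness builds the
    derivation of the premise afresh.\<close>
  unfolding CAN_free_invertible_def
  by (meson CAN_free_derivable_imp_valid logical_rule_valid_premise valid_imp_CAN_free_derivable)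

end
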